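(* Let $A\in\mathbb{C}^{n\times n}$ have index $k$, with $r:=\operatorname{rank}(A^{\sim}AA^{\sim})=\operatorname{rank}(A)<n$, and be written as $$A=U\begin{pmatrix}\Sigma K&\Sigma L\\ 0&0\end{pmatrix}U^{*},$$ where $U\in\mathbb{C}^{n\times n}$ is unitary, $\Sigma=\operatorname{diag}(\sigma_1,\dots,\sigma_r)$ is the diagonal matrix of the singular values $\sigma_i>0$ of $A$, and $K\in\mathbb{C}^{r\times r}$, $L\in\mathbb{C}^{r\times(n-r)}$ satisfy $KK^{*}+LL^{*}=I_r$. Let $G$ be the Minkowski metric matrix of order $n$, partitioned as $$G=U\begin{pmatrix}G_1&G_2\\ G_2^{*}&G_4\end{pmatrix}U^{*},\qquad G_1\in\mathbb{C}^{r\times r},\ G_2\in\mathbb{C}^{r\times(n-r)},\ G_4\in\mathbb{C}^{(n-r)\times(n-r)}.$$ Let $b\in\mathbb{C}^{n}$ be $b=GU\begin{pmatrix}b_1\\ b_2\end{pmatrix}$, where $b_1\in\mathbb{C}^{r}$ satisfies $G_1^{-1}b_1\in\mathcal{R}((\Sigma K)^{D})$ and $b_2\in\mathbb{C}^{n-r}$. Then $$\min_{x\in\mathcal{R}(A^{k})}\left\Vert(AA^{\dagger})^{\sim}Ax-b\right\Vert_{F}=\Vert b_2\Vert_{F}.$$ Moreover, $x=A^{D,\mathfrak{m}}b$ is the unique solution of this minimization problem (the unique $x\in\mathcal{R}(A^{k})$ attaining the minimum).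
   Context: $\mathcal{R}(\cdot)$ denotes the range, $\Vert\cdot\Vert_F$ the Frobenius norm (the Euclidean norm on vectors), and $A^{\dagger}$ the Moore–Penrose inverse. The index of $A\in\mathbb{C}^{n\times n}$ is the smallest nonnegative integer $k$ with $\operatorname{rank}(A^{k+1})=\operatorname{rank}(A^{k})$. The Minkowski metric matrix of order $n$ is $G=\operatorname{diag}(1,-I_{n-1})$. For $A\in\mathbb{C}^{n\times n}$, the Minkowski adjoint is $A^{\sim}=GA^{*}G$, where $A^*$ is the conjugate transpose. The Drazin inverse $A^{D}$ of a square matrix $A$ of index $k$ is the unique $X$ with $XAX=X$, $AX=XA$, $A^{k+1}X=A^{k}$. The Minkowski inverse $A^{\mathfrak{m}}$ is the unique matrix $X$ (if it exists) with $AXA=A$, $XAX=X$, $(AX)^{\sim}=AX$, $(XA)^{\sim}=XA$; it exists if and only if $\operatorname{rank}(A^{\sim}AA^{\sim})=\operatorname{rank}(A)$. When it exists, the $\mathfrak{m}$-DMP inverse of $A$ is $A^{D,\mathfrak{m}}=A^{D}AA^{\mathfrak{m}}$. Every $A\in\mathbb{C}^{n\times n}$ has a decomposition of the displayed form (the Hartwig–Spindelböck decomposition); under the rank hypothesis $G_1$ is nonsingular. *)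

theory Defs
  imports
    "Jordan_Normal_Form.DL_Rank"
    "Jordan_Normal_Form.Char_Poly"
    "Jordan_Normal_Form.Schur_Decomposition"
    "Jordan_Normal_Form.Gauss_Jordan_Elimination"
begin

abbreviation crank :: "complex mat \<Rightarrow> nat" where
  "crank A \<equiv> vec_space.rank (dim_row A) A"

definition mat_range :: "complex mat \<Rightarrow> complex vec set" where
  "mat_range A = (\<lambda>x. A *\<^sub>v x) ` carrier_vec (dim_col A)"

definition fnorm :: "complex vec \<Rightarrow> real" where
  "fnorm v = sqrt (\<Sum>i<dim_vec v. (cmod (v $ i))\<^sup>2)"

definition unitary_mat :: "complex mat \<Rightarrow> bool" where
  "unitary_mat U \<longleftrightarrow> square_mat U \<and>
     mat_adjoint U * U = 1\<^sub>m (dim_row U) \<and> U * mat_adjoint U = 1\<^sub>m (dim_row U)"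

text \<open>The singular values are the square roots of the eigenvalues of \<open>A\<^sup>*A\<close>, listed with
  algebraic multiplicity (these eigenvalues are real and nonnegative).\<close>

definition singular_values :: "complex mat \<Rightarrow> real multiset" where
  "singular_values A = image_mset (\<lambda>z. sqrt (Re z)) (proots (char_poly (mat_adjoint A * A)))"

definition mat_index :: "complex mat \<Rightarrow> nat" where
  "mat_index A = (LEAST k. crank (A ^\<^sub>m (k + 1)) = crank (A ^\<^sub>m k))"

definition minkowski_metric :: "nat \<Rightarrow> complex mat" where
  "minkowski_metric n = mat_diag n (\<lambda>i. if i = 0 then 1 else - 1)"

text \<open>The Minkowski adjoint, the Drazin, Minkowski and m-DMP inverses are meant for square
  matrices only.\<close>

definition minkowski_adjoint :: "complex mat \<Rightarrow> complex mat" where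
  "minkowski_adjoint A = minkowski_metric (dim_row A) * mat_adjoint A * minkowski_metric (dim_row A)"

text \<open>The inverses below are unique whenever they exist; the Moore--Penrose inverse and, for
  square \<open>A\<close>, the Drazin inverse always exist. The Minkowski inverse exists if and only if
  \<open>A\<^sup>\<sim>AA\<^sup>\<sim>\<close> has the same rank as \<open>A\<close>; otherwise its value is unspecified.\<close>

definition moore_penrose_inverse :: "complex mat \<Rightarrow> complex mat" where
  "moore_penrose_inverse A = (THE X. X \<in> carrier_mat (dim_col A) (dim_row A) \<and>
     A * X * A = A \<and> X * A * X = X \<and>
     mat_adjoint (A * X) = A * X \<and> mat_adjoint (X * A) = X * A)"

definition drazin_inverse :: "complex mat \<Rightarrow> complex mat" where
  "drazin_inverse A = (THE X. X \<in> carrier_mat (dim_row A) (dim_row A) \<and>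
     X * A * X = X \<and> A * X = X * A \<and>
     A ^\<^sub>m (mat_index A + 1) * X = A ^\<^sub>m (mat_index A))"

definition minkowski_inverse :: "complex mat \<Rightarrow> complex mat" where
  "minkowski_inverse A = (THE X. X \<in> carrier_mat (dim_row A) (dim_row A) \<and>
     A * X * A = A \<and> X * A * X = X \<and>
     minkowski_adjoint (A * X) = A * X \<and> minkowski_adjoint (X * A) = X * A)"

definition m_DMP_inverse :: "complex mat \<Rightarrow> complex mat" where
  "m_DMP_inverse A = drazin_inverse A * A * minkowski_inverse A"

end

theory Submission
  imports Defs
begin

text \<open>
  Let \<open>F\<close> consist of the first \<open>r\<close> columns of \<open>U\<close> and put \<open>H = (\<Sigma>K, \<Sigma>L) U\<^sup>*\<close>. The given decomposition
  is then the full rank factorization \<open>A = F H\<close>, with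

    \<open>F\<^sup>* F = I\<close>,  \<open>H H\<^sup>* = \<Sigma>\<^sup>2\<close>,  \<open>H F = \<Sigma>K\<close>,  \<open>F\<^sup>* G F = G1\<close>.

  The orthogonal projection \<open>A A\<^sup>\<dagger>\<close> is \<open>F F\<^sup>*\<close>, so \<open>(A A\<^sup>\<dagger>)\<^sup>\<sim> A x = G F (G1 H x)\<close> and

    \<open>(A A\<^sup>\<dagger>)\<^sup>\<sim> A x - b = G U (G1 H x - b1, - b2)\<close>.

  As \<open>G U\<close> is unitary, the squared norm of the residual is \<open>\<parallel>G1 H x - b1\<parallel>\<^sup>2 + \<parallel>b2\<parallel>\<^sup>2\<close>. It is at least
  \<open>\<parallel>b2\<parallel>\<^sup>2\<close>, with equality exactly when \<open>H x = c\<close> for \<open>c = G1\<^sup>-\<^sup>1 b1\<close>, that is, when \<open>A x = F c\<close>.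

  By the hypothesis on \<open>b1\<close>, the vector \<open>c\<close> lies in the range of \<open>(\<Sigma>K)\<^sup>D\<close> and so in the range of
  \<open>(\<Sigma>K)\<^sup>k\<close>; since \<open>A F = F (\<Sigma>K)\<close>, the vector \<open>F c\<close> lies in the range of \<open>A\<^sup>k\<close>. There \<open>A\<close> is
  bijective with inverse \<open>A\<^sup>D\<close> (\<open>drazin_inverse_on_core_range\<close>), so \<open>x = A\<^sup>D F c\<close> is the only solution of
  \<open>A x = F c\<close> in this range. Finally the Minkowski inverse of \<open>F H\<close> has an explicit formula
  (\<open>minkowski_inverse_of_full_rank_factorization\<close>), from which \<open>A\<close> times the Minkowski inverse sends
  \<open>b\<close> to \<open>F c\<close>, and therefore \<open>A\<^sup>D F c\<close> is the m-DMP inverse applied to \<open>b\<close>.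

  The formula requires the two Gram matrices \<open>G1\<close> and \<open>H G H\<^sup>*\<close> to be nonsingular. Both are inner factors of
  \<open>A\<^sup>\<sim> A A\<^sup>\<sim>\<close>, which has rank \<open>r\<close> (\<open>full_rank_product_middle_inverse\<close>). Existence of the Drazin
  inverse and invertibility of these factors both come from rank factorizations
  (\<open>rank_factorization\<close>).
\<close>

section \<open>Rank factorizations\<close>

text \<open>The side conditions here mention dimensions only, so that simplification can reassociate products
of rectangular matrices; \<open>assoc_mult_mat\<close> would have to guess the intermediate carriers.\<close>

lemma mult_assoc_mat_dims:
  fixes A :: "'a::semiring_0 mat"
  assumes "dim_col A = dim_row B" "dim_col B = dim_row C"
  shows "A * B * C = A * (B * C)"
  using assms by (intro assoc_mult_mat) auto

lemma mult_assoc_mat_vec_dims: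
  fixes A :: "'a::semiring_0 mat"
  assumes "dim_col A = dim_row B" "dim_col B = dim_vec v"
  shows "A * B *\<^sub>v v = A *\<^sub>v (B *\<^sub>v v)"
  using assms by (intro assoc_mult_mat_vec) auto

definition inj_mat :: "'a::field mat \<Rightarrow> bool" where
  "inj_mat P \<longleftrightarrow> (\<forall>v\<in>carrier_vec (dim_col P). P *\<^sub>v v = 0\<^sub>v (dim_row P) \<longrightarrow> v = 0\<^sub>v (dim_col P))"

lemma inj_mat_left_cancel:
  assumes P: "inj_mat P" and C: "dim_row C = dim_col P" and D: "dim_row D = dim_col P"
    and eq: "P * C = P * D"
  shows "C = D"
proof (rule mat_col_eqI)
  have "dim_col (P * C) = dim_col (P * D)" using eq by simp
  then show dc: "dim_col C = dim_col D" by simp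
  show "dim_row C = dim_row D" using C D by simp
  fix i assume i: "i < dim_col D"
  have c: "col C i \<in> carrier_vec (dim_col P)" "col D i \<in> carrier_vec (dim_col P)"
    using C D by (auto simp: carrier_vecI)
  have "P *\<^sub>v col C i = col (P * C) i" using i dc C by (intro eq_vecI) auto
  also have "\<dots> = P *\<^sub>v col D i" unfolding eq using i D by (intro eq_vecI) auto
  finally have "P *\<^sub>v (col C i - col D i) = 0\<^sub>v (dim_row P)"
    using c by (subst mult_minus_distrib_mat_vec[where nr="dim_row P" and nc="dim_col P"]) auto
  then have "col C i - col D i = 0\<^sub>v (dim_col P)" using P c unfolding inj_mat_def by auto
  then have "\<And>j. j < dim_col P \<Longrightarrow> col C i $ j = col D i $ j"
    by (metis (no_types, lifting) c(1) c(2) carrier_vecD eq_iff_diff_eq_0 index_minus_vec(1) index_zero_vec(1))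
  then show "col C i = col D i" using C D by (intro eq_vecI) auto
qed

lemma inj_mat_of_factor:
  assumes "inj_mat (P * C)" and "dim_col P = dim_row C"
  shows "inj_mat C"
proof -
  have "P *\<^sub>v 0\<^sub>v (dim_row C) = 0\<^sub>v (dim_row P)" using assms(2)
    by (intro eq_vecI) (auto simp: scalar_prod_def)
  with assms show ?thesis unfolding inj_mat_def by (auto simp: mult_assoc_mat_vec_dims)
qed

text \<open>Padding \<open>C\<close> with zero rows to a square matrix when \<open>s < t\<close> gives determinant zero, hence a
nonzero kernel vector, and that vector is already killed by \<open>C\<close>.\<close>

lemma inj_mat_dim_le:
  fixes C :: "'a::field mat"
  assumes C: "C \<in> carrier_mat s t" and inj: "inj_mat C"
  shows "t \<le> s"
proof (rule ccontr)
  assume "\<not> t \<le> s"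
  then have st: "s < t" by simp
  define E where "E = mat t t (\<lambda>(i,j). if i < s then C $$ (i,j) else 0)"
  have E: "E \<in> carrier_mat t t" by (simp add: E_def)
  have "E\<^sup>T *\<^sub>v unit_vec t (t - 1) = 0\<^sub>v t"
    using st by (intro eq_vecI) (auto simp: E_def)
  moreover have "unit_vec t (t - 1) \<noteq> (0\<^sub>v t :: 'a vec)"
    using st by (metis diff_less index_unit_vec(1) index_zero_vec(1) less_one less_zeroE linorder_neqE_nat zero_neq_one)
  ultimately have "det (E\<^sup>T) = 0"
    using det_0_iff_vec_prod_zero_field[of "E\<^sup>T" t] E by (metis transpose_carrier_mat unit_vec_carrier)
  then have "det E = 0" using det_transpose[OF E] by simp
  then obtain v where v: "v \<in> carrier_vec t" "v \<noteq> 0\<^sub>v t" "E *\<^sub>v v = 0\<^sub>v t"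
    using det_0_iff_vec_prod_zero_field[OF E] by blast
  have "C *\<^sub>v v = 0\<^sub>v s"
  proof (rule eq_vecI)
    fix i assume "i < dim_vec (0\<^sub>v s :: 'a vec)"
    then have i: "i < s" by simp
    have "row C i = row E i" using i st C by (intro eq_vecI) (auto simp: E_def)
    then have "(C *\<^sub>v v) $ i = (E *\<^sub>v v) $ i" using i st C E by simp
    then show "(C *\<^sub>v v) $ i = 0\<^sub>v s $ i" using v i st by simp
  qed (use C in simp)
  then show False using inj C v unfolding inj_mat_def by auto
qed

lemma inj_mat_square_inverse:
  fixes C :: "'a::field mat"
  assumes C: "C \<in> carrier_mat s s" and inj: "inj_mat C"
  obtains D where "D \<in> carrier_mat s s" "C * D = 1\<^sub>m s" "D * C = 1\<^sub>m s"
proof -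
  have "det C \<noteq> 0"
    using det_0_iff_vec_prod_zero_field[OF C] inj C unfolding inj_mat_def by auto
  from det_non_zero_imp_unit[OF C this, of undefined] show ?thesis
    by (auto simp: Units_def ring_mat_def intro: that)
qed

lemma factor_through_columns:
  fixes P :: "'a::semiring_0 mat"
  assumes P: "P \<in> carrier_mat n s" and M: "M \<in> carrier_mat n m"
    and q: "\<And>j. j < m \<Longrightarrow> \<exists>q\<in>carrier_vec s. P *\<^sub>v q = col M j"
  obtains Q where "Q \<in> carrier_mat s m" "M = P * Q"
proof -
  obtain f where f: "\<And>j. j < m \<Longrightarrow> f j \<in> carrier_vec s \<and> P *\<^sub>v f j = col M j"
    using q by metis
  define Q where "Q = mat_of_cols s (map f [0..<m])"
  have Q: "Q \<in> carrier_mat s m" unfolding Q_def by auto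
  have "M = P * Q"
  proof (rule mat_col_eqI)
    fix j assume "j < dim_col (P * Q)"
    then have j: "j < m" using Q by simp
    have "col (P * Q) j = P *\<^sub>v col Q j" using j P Q by (intro eq_vecI) auto
    also have "col Q j = f j" using f j unfolding Q_def by (subst col_mat_of_cols) auto
    finally show "col M j = col (P * Q) j" using f j by simp
  qed (use P Q M in auto)
  with Q show ?thesis by (rule that)
qed

text \<open>The columns of \<open>P\<close> are a maximal independent set of columns of \<open>M\<close>. The matrix \<open>Z\<close>, which
picks those columns out of \<open>M\<close>, replaces a statement about ranges: whatever factorization \<open>M\<close>
has, \<open>P = M Z\<close> inherits it, and then the injectivity of \<open>P\<close> gives information on the factors.
The rank arguments below all have this form.\<close>

lemma rank_factorization:
  fixes M :: "'a::field mat"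
  assumes M: "M \<in> carrier_mat n m" and s: "s = vec_space.rank n M"
  obtains P Q Z where "P \<in> carrier_mat n s" "Q \<in> carrier_mat s m" "Z \<in> carrier_mat m s"
    "M = P * Q" "P = M * Z" "inj_mat P"
proof -
  interpret vec_space "TYPE('a)" n .
  let ?ind = "\<lambda>T. T \<subseteq> set (cols M) \<and> lin_indpt T"
  have cM: "set (cols M) \<subseteq> carrier_vec n" using M cols_dim by blast
  obtain S where S: "maximal S ?ind"
    using maximal_exists[of ?ind "card (set (cols M))" "{}"]
    by (meson List.finite_set card_mono empty_iff empty_subsetI finite_lin_indpt2 rev_finite_subset)
  then have SM: "S \<subseteq> set (cols M)" and li: "lin_indpt S" by (auto simp: maximal_def)
  have finS: "finite S" using SM finite_subset by blast
  obtain bs where bs: "set bs = S" "distinct bs" using finite_distinct_list[OF finS] by blast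
  have len: "length bs = s"
    using rank_card_indpt[OF M S] bs s distinct_card by metis
  define P where "P = mat_of_cols n bs"
  have P: "P \<in> carrier_mat n s" unfolding P_def using len by auto
  have cP: "cols P = bs" unfolding P_def using bs SM cM by (intro cols_mat_of_cols) auto
  have inj: "inj_mat P"
    unfolding inj_mat_def using lin_depI[OF P] cP bs li P by auto
  have spanP: "\<exists>q\<in>carrier_vec s. P *\<^sub>v q = c" if c: "c \<in> set (cols M)" for c
  proof -
    have "c \<in> span S"
    proof (cases "c \<in> S")
      case True then show ?thesis using SM cM in_own_span by blast
    next
      case False
      then have "lin_dep (S \<union> {c})" using S c SM unfolding maximal_def by blast
      then show ?thesis using lin_dep_iff_in_span[of S c] li c cM SM False by blast
    qed
    then have "c \<in> col_space P" unfolding col_space_def cP bs .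
    then show ?thesis using col_space_eq[OF P] P by auto
  qed
  obtain Q where Q: "Q \<in> carrier_mat s m" "M = P * Q"
  proof (rule factor_through_columns[OF P M])
    fix j assume "j < m"
    then show "\<exists>q\<in>carrier_vec s. P *\<^sub>v q = col M j"
      using M by (intro spanP) (auto simp: cols_def)
  qed
  obtain Z where Z: "Z \<in> carrier_mat m s" "P = M * Z"
  proof (rule factor_through_columns[OF M P])
    fix j assume j: "j < s"
    then have "col P j \<in> set (cols M)" using cP bs SM len P
      by (metis cols_length cols_nth nth_mem subsetD)
    then obtain i where "i < m" "col P j = col M i" using M by (auto simp: cols_def)
    then show "\<exists>q\<in>carrier_vec m. M *\<^sub>v q = col P j"
      using M by (intro bexI[of _ "unit_vec m i"] eq_vecI) auto
  qed
  show ?thesis by (rule that[OF P Q(1) Z(1) Q(2) Z(2) inj])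
qed

text \<open>In coordinates given by the rank factorizations of \<open>M\<close> and \<open>M W\<close>, the inclusion of the range of
\<open>M W\<close> in that of \<open>M\<close> is an injective matrix \<open>C\<close>. It cannot be wide, and if the ranks agree it is
square, hence invertible, which reverses the inclusion.\<close>

lemma rank_mult_right:
  fixes M :: "'a::field mat"
  assumes M: "M \<in> carrier_mat n m" and W: "W \<in> carrier_mat m l"
  shows rank_mult_right_le: "vec_space.rank n (M * W) \<le> vec_space.rank n M"
    and rank_mult_right_eqD: "vec_space.rank n (M * W) = vec_space.rank n M \<Longrightarrow>
      \<exists>V\<in>carrier_mat l m. M = M * W * V"
proof -
  define s t where "s = vec_space.rank n M" and "t = vec_space.rank n (M * W)"
  obtain P Q Z where P: "P \<in> carrier_mat n s" "Q \<in> carrier_mat s m" "Z \<in> carrier_mat m s"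
    "M = P * Q" "P = M * Z" "inj_mat P"
    using rank_factorization[OF M s_def] .
  obtain P2 Q2 Z2 where P2: "P2 \<in> carrier_mat n t" "Q2 \<in> carrier_mat t l" "Z2 \<in> carrier_mat l t"
    "M * W = P2 * Q2" "P2 = M * W * Z2" "inj_mat P2"
    using rank_factorization[OF mult_carrier_mat[OF M W] t_def] .
  define C where "C = Q * W * Z2"
  have C: "C \<in> carrier_mat s t" using P(2) P2(3) W unfolding C_def by auto
  have "P2 = P * Q * W * Z2" using P2(5) unfolding P(4) .
  also have "\<dots> = P * C" unfolding C_def using P(1,2) P2(3) W
    by (simp add: mult_assoc_mat_dims)
  finally have PC: "P2 = P * C" .
  have injC: "inj_mat C"
  proof (rule inj_mat_of_factor)
    show "inj_mat (P * C)" using P2(6) unfolding PC .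
  qed (use P(1) C in simp)
  show "vec_space.rank n (M * W) \<le> vec_space.rank n M"
    using inj_mat_dim_le[OF C injC] unfolding s_def t_def .
  assume "vec_space.rank n (M * W) = vec_space.rank n M"
  then have st: "t = s" unfolding s_def t_def .
  obtain D where D: "D \<in> carrier_mat s s" "C * D = 1\<^sub>m s" "D * C = 1\<^sub>m s"
    using inj_mat_square_inverse[OF C[unfolded st] injC] .
  have "M * W * (Z2 * D * Q) = P2 * (D * Q)"
    using arg_cong[OF P2(5), of "\<lambda>T. T * (D * Q)"] M W P2(3) P(2) D(1) st
    by (simp add: mult_assoc_mat_dims)
  also have "\<dots> = P * (C * D * Q)"
    unfolding PC using P(1,2) C D(1) st by (simp add: mult_assoc_mat_dims)
  also have "\<dots> = M" using D P(2) P(4)[symmetric] by simp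
  finally have "M = M * W * (Z2 * D * Q)" by simp
  moreover have "Z2 * D * Q \<in> carrier_mat l m" using P2(3) P(2) D(1) st by auto
  ultimately show "\<exists>V\<in>carrier_mat l m. M = M * W * V" by blast
qed

text \<open>If an \<open>r\<close>-dimensional space is squeezed through \<open>S\<close> without loss of rank, then \<open>S\<close> is nonsingular.
This turns the rank hypothesis of the theorem into the existence of the two inverses that build the
Minkowski inverse.\<close>

lemma full_rank_product_middle_inverse:
  fixes S :: "'a::field mat"
  assumes X: "X \<in> carrier_mat n r" and S: "S \<in> carrier_mat r r" and Y: "Y \<in> carrier_mat r m"
    and rank: "vec_space.rank n (X * S * Y) = r"
  obtains D where "D \<in> carrier_mat r r" "S * D = 1\<^sub>m r" "D * S = 1\<^sub>m r"
proof -
  have M: "X * S * Y \<in> carrier_mat n m" using X S Y by auto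
  obtain P Q Z where P: "P \<in> carrier_mat n r" "Q \<in> carrier_mat r m" "Z \<in> carrier_mat m r"
    "X * S * Y = P * Q" "P = X * S * Y * Z" "inj_mat P"
    using rank_factorization[OF M rank[symmetric]] .
  have "P = X * (S * (Y * Z))" unfolding P(5) using X S Y P(3) by (simp add: mult_assoc_mat_dims)
  then have "inj_mat (S * (Y * Z))"
    using P(6) X S Y P(3) by (metis inj_mat_of_factor carrier_matD index_mult_mat(2))
  then obtain D where D: "D \<in> carrier_mat r r" "S * (Y * Z) * D = 1\<^sub>m r"
    using inj_mat_square_inverse[of "S * (Y * Z)" r] S Y P(3) by (metis mult_carrier_mat)
  have c: "Y * Z * D \<in> carrier_mat r r" using Y P(3) D by auto
  have "S * (Y * Z * D) = 1\<^sub>m r" using D S Y P(3) by (simp add: mult_assoc_mat_dims)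
  with c mat_mult_left_right_inverse[OF S c this] show ?thesis by (intro that)
qed

section \<open>Index and Drazin inverse\<close>

lemma nat_seq_stationary:
  fixes f :: "nat \<Rightarrow> nat"
  assumes "\<And>k. f (Suc k) \<le> f k"
  shows "\<exists>k. f (Suc k) = f k"
proof (rule ccontr)
  assume "\<not> ?thesis"
  then have lt: "f (Suc k) < f k" for k using assms le_neq_implies_less by metis
  have "f k + k \<le> f 0" for k
  proof (induction k)
    case (Suc k) then show ?case using lt[of k] by linarith
  qed simp
  from this[of "Suc (f 0)"] show False by simp
qed

lemma pow_mat_Suc_left:
  assumes A: "A \<in> carrier_mat n n"
  shows "A ^\<^sub>m Suc k = A * A ^\<^sub>m k"
proof (induction k)
  case (Suc k)
  have "A ^\<^sub>m Suc (Suc k) = (A * A ^\<^sub>m k) * A" using Suc by simp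
  also have "\<dots> = A * A ^\<^sub>m Suc k" using A by (simp add: mult_assoc_mat_dims)
  finally show ?case .
qed (use A in simp)

lemma pow_mat_intertwine:
  assumes A: "A \<in> carrier_mat n n" and T: "T \<in> carrier_mat r r" and P: "P \<in> carrier_mat n r"
    and AP: "A * P = P * T"
  shows "A ^\<^sub>m k * P = P * T ^\<^sub>m k"
proof (induction k)
  case (Suc k)
  have "A ^\<^sub>m Suc k * P = A ^\<^sub>m k * P * T" using A P T AP by (simp add: mult_assoc_mat_dims)
  also have "\<dots> = P * T ^\<^sub>m Suc k" using Suc A P T by (simp add: mult_assoc_mat_dims)
  finally show ?case .
qed (use A P T in simp)

text \<open>At the index the descending chain of ranges of the powers of \<open>A\<close> becomes stationary, which the
matrix \<open>Y\<close> witnesses.\<close>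

lemma pow_mat_index_factor:
  assumes A: "A \<in> carrier_mat n n"
  obtains Y where "Y \<in> carrier_mat n n" "A ^\<^sub>m mat_index A = A ^\<^sub>m Suc (mat_index A) * Y"
proof -
  let ?f = "\<lambda>k. crank (A ^\<^sub>m k)"
  have "?f (Suc k) \<le> ?f k" for k
    using rank_mult_right_le[OF pow_carrier_mat[OF A] A] A by simp
  then have ex: "\<exists>k. crank (A ^\<^sub>m (k + 1)) = crank (A ^\<^sub>m k)"
    using nat_seq_stationary[of ?f] by auto
  have "crank (A ^\<^sub>m (mat_index A + 1)) = crank (A ^\<^sub>m mat_index A)"
    unfolding mat_index_def by (rule LeastI_ex[OF ex])
  then have "vec_space.rank n (A ^\<^sub>m mat_index A * A) = vec_space.rank n (A ^\<^sub>m mat_index A)"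
    using A by simp
  from rank_mult_right_eqD[OF pow_carrier_mat[OF A] A this] show ?thesis
    using that by auto
qed

definition is_drazin_inverse :: "complex mat \<Rightarrow> complex mat \<Rightarrow> bool" where
  "is_drazin_inverse A X \<longleftrightarrow> X \<in> carrier_mat (dim_row A) (dim_row A) \<and>
     X * A * X = X \<and> A * X = X * A \<and>
     A ^\<^sub>m (mat_index A + 1) * X = A ^\<^sub>m (mat_index A)"

text \<open>Let \<open>A\<^sup>k = P Q\<close> be a rank factorization. As the range of \<open>P\<close> is the stable range of \<open>A\<close>, there is
a square matrix \<open>T\<close> with \<open>A P = P T\<close>, and \<open>T\<close> is invertible because \<open>A\<close> maps the stable range
onto itself. Cancelling \<open>P\<close> gives \<open>Q A = T Q\<close> and \<open>Q P = T\<^sup>k\<close>, and with \<open>N\<close> the inverse of \<open>T\<close>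
the matrix \<open>P N\<^sup>k\<^sup>+\<^sup>1 Q\<close> inverts \<open>A\<close> on the stable range and kills the rest.\<close>

lemma is_drazin_inverse_exists:
  assumes A: "A \<in> carrier_mat n n"
  shows "\<exists>X. is_drazin_inverse A X"
proof -
  define k where "k = mat_index A"
  define s where "s = vec_space.rank n (A ^\<^sub>m k)"
  have Ak: "A ^\<^sub>m k \<in> carrier_mat n n" using A by simp
  obtain Y where Y: "Y \<in> carrier_mat n n" "A ^\<^sub>m k = A ^\<^sub>m Suc k * Y"
    using pow_mat_index_factor[OF A] unfolding k_def .
  obtain P Q Z where P: "P \<in> carrier_mat n s" and Q: "Q \<in> carrier_mat s n" and Z: "Z \<in> carrier_mat n s"
    and PQ: "A ^\<^sub>m k = P * Q" and PZ: "P = A ^\<^sub>m k * Z" and inj: "inj_mat P"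
    using rank_factorization[OF Ak s_def] .
  note dims = carrier_matD[OF A] carrier_matD[OF P] carrier_matD[OF Q] carrier_matD[OF Z]
    carrier_matD[OF Y(1)]
  define T where "T = Q * A * Z"
  have T: "T \<in> carrier_mat s s" unfolding T_def using A Q Z by auto
  have "A * P = A ^\<^sub>m Suc k * Z"
    using arg_cong[OF PZ, of "\<lambda>M. A * M"] dims by (simp add: pow_mat_Suc_left[OF A] mult_assoc_mat_dims del: pow_mat.simps)
  also have "\<dots> = P * T"
    unfolding T_def using dims by (simp add: PQ mult_assoc_mat_dims)
  finally have AP: "A * P = P * T" .
  have "P * 1\<^sub>m s = A ^\<^sub>m Suc k * (Y * Z)"
    using arg_cong[OF Y(2), of "\<lambda>M. M * Z"] PZ[symmetric] dims by (simp add: mult_assoc_mat_dims)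
  also have "\<dots> = A * P * (Q * (Y * Z))"
    unfolding pow_mat_Suc_left[OF A] PQ using dims by (simp add: mult_assoc_mat_dims)
  also have "\<dots> = P * (T * (Q * (Y * Z)))"
    unfolding AP using dims T by (simp add: mult_assoc_mat_dims)
  finally have "T * (Q * (Y * Z)) = 1\<^sub>m s"
    using inj_mat_left_cancel[OF inj] dims T by (metis carrier_matD(1) index_mult_mat(2) index_one_mat(2))
  moreover define N where "N = Q * (Y * Z)"
  ultimately have TN: "T * N = 1\<^sub>m s" by simp
  have N: "N \<in> carrier_mat s s" unfolding N_def using Y Q Z by auto
  \<comment> \<open>\<open>N\<close> came out as a right inverse only, because \<open>P\<close> cancels on the left.\<close>
  have NT: "N * T = 1\<^sub>m s" by (rule mat_mult_left_right_inverse[OF T N TN])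
  have TNp: "T ^\<^sub>m j * N ^\<^sub>m j = 1\<^sub>m s" for j
  proof (induction j)
    case (Suc j)
    have "T ^\<^sub>m Suc j * N ^\<^sub>m Suc j = T * (T ^\<^sub>m j * N ^\<^sub>m j) * N"
      unfolding pow_mat_Suc_left[OF T] using T N by (simp add: mult_assoc_mat_dims)
    then show ?case using Suc T N TN by simp
  qed (use T N in simp)
  note [simp] = carrier_matD[OF T] carrier_matD[OF N]
  \<comment> \<open>Two readings of \<open>A\<^sup>k\<^sup>+\<^sup>1\<close>, as \<open>A\<^sup>k A\<close> and as \<open>A A\<^sup>k\<close>.\<close>
  have "P * (Q * A) = A ^\<^sub>m Suc k" using dims by (simp add: PQ mult_assoc_mat_dims)
  also have "\<dots> = P * (T * Q)"
    unfolding pow_mat_Suc_left[OF A] PQ using AP dims by (simp add: mult_assoc_mat_dims[symmetric])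
  finally have QA: "Q * A = T * Q" using inj_mat_left_cancel[OF inj] dims by simp
  have "P * (Q * P) = P * T ^\<^sub>m k"
    using pow_mat_intertwine[OF A T P AP, of k] dims unfolding PQ by (simp add: mult_assoc_mat_dims)
  then have QP: "Q * P = T ^\<^sub>m k" using inj_mat_left_cancel[OF inj] dims by simp
  define X where "X = P * N ^\<^sub>m Suc k * Q"
  have X: "X \<in> carrier_mat n n" unfolding X_def
    by (rule mult_carrier_mat[OF mult_carrier_mat[OF P pow_carrier_mat[OF N]] Q])
  have "A * X = A * P * N ^\<^sub>m Suc k * Q" unfolding X_def using dims by (simp add: mult_assoc_mat_dims)
  also have "\<dots> = P * (T * N) * N ^\<^sub>m k * Q"
    unfolding AP pow_mat_Suc_left[OF N] using dims by (simp add: mult_assoc_mat_dims)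
  finally have AX: "A * X = P * N ^\<^sub>m k * Q" using TN P by simp
  have "X * A = P * N ^\<^sub>m k * N * (Q * A)" unfolding X_def using dims by (simp add: mult_assoc_mat_dims)
  also have "\<dots> = P * N ^\<^sub>m k * (N * T) * Q" unfolding QA using dims by (simp add: mult_assoc_mat_dims)
  finally have XA: "X * A = P * N ^\<^sub>m k * Q" using NT P N dims by simp
  have "X * A * X = P * N ^\<^sub>m k * (Q * P) * N ^\<^sub>m Suc k * Q"
    using arg_cong[OF XA, of "\<lambda>M. M * (P * N ^\<^sub>m Suc k * Q)"] dims unfolding X_def
    by (simp add: mult_assoc_mat_dims)
  also have "\<dots> = P * N ^\<^sub>m k * (T ^\<^sub>m k * N ^\<^sub>m k) * N * Q"
    unfolding QP using dims by (simp add: mult_assoc_mat_dims)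
  also have "\<dots> = X" unfolding TNp X_def using dims by (simp add: mult_assoc_mat_dims)
  finally have XAX: "X * A * X = X" .
  have "A ^\<^sub>m (k + 1) * X = P * (Q * P) * N ^\<^sub>m k * Q"
    using AX dims X by (simp add: PQ mult_assoc_mat_dims)
  also have "\<dots> = P * (T ^\<^sub>m k * N ^\<^sub>m k) * Q" unfolding QP using dims by (simp add: mult_assoc_mat_dims)
  also have "\<dots> = A ^\<^sub>m k" unfolding TNp PQ using P by simp
  finally have "A ^\<^sub>m (k + 1) * X = A ^\<^sub>m k" .
  then show ?thesis
    using X XAX AX XA carrier_matD[OF A] unfolding is_drazin_inverse_def k_def by (intro exI[of _ X]) simp
qed

text \<open>Commutation turns \<open>X = X A X\<close> into \<open>X = A X\<^sup>2\<close>, which is iterated. In particular the range of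
\<open>X\<close> lies in that of every power of \<open>A\<close>.\<close>

lemma drazin_collapse:
  assumes A: "A \<in> carrier_mat n n" and X: "X \<in> carrier_mat n n"
    and XAX: "X * A * X = X" and AX: "A * X = X * A"
  shows "X = A ^\<^sub>m j * X ^\<^sub>m Suc j"
proof (induction j)
  case (Suc j)
  have "A ^\<^sub>m Suc j * X ^\<^sub>m Suc (Suc j) = A ^\<^sub>m j * (A * X * X) * X ^\<^sub>m j"
    unfolding pow_mat_Suc_left[OF X] using A X by (simp add: mult_assoc_mat_dims)
  also have "A * X * X = X" using XAX AX by simp
  also have "A ^\<^sub>m j * X * X ^\<^sub>m j = A ^\<^sub>m j * X ^\<^sub>m Suc j"
    unfolding pow_mat_Suc_left[OF X] using A X by (simp add: mult_assoc_mat_dims)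
  finally show ?case using Suc by simp
qed (use A X in simp)

text \<open>Both \<open>X\<close> and \<open>Y\<close> equal \<open>X A Y\<close>: write \<open>Y = A\<^sup>k Y\<^sup>k\<^sup>+\<^sup>1\<close> and absorb \<open>X A\<close> into \<open>A\<^sup>k\<close>, or write
\<open>X = X\<^sup>k\<^sup>+\<^sup>1 A\<^sup>k\<close> and absorb \<open>A Y\<close>.\<close>

lemma is_drazin_inverse_unique:
  assumes A: "A \<in> carrier_mat n n" and X: "is_drazin_inverse A X" and Y: "is_drazin_inverse A Y"
  shows "X = Y"
proof -
  define k where "k = mat_index A"
  have X: "X \<in> carrier_mat n n" "X * A * X = X" "A * X = X * A" "A ^\<^sub>m Suc k * X = A ^\<^sub>m k"
    and Y: "Y \<in> carrier_mat n n" "Y * A * Y = Y" "A * Y = Y * A" "A ^\<^sub>m Suc k * Y = A ^\<^sub>m k"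
    using X Y A unfolding is_drazin_inverse_def k_def by auto
  note dims = carrier_matD[OF A] carrier_matD[OF X(1)] carrier_matD[OF Y(1)]
  have "X * A ^\<^sub>m Suc k = A ^\<^sub>m k"
    using pow_mat_intertwine[OF A A X(1) X(3), of "Suc k"] X(4) by simp
  then have XAk: "X * A * A ^\<^sub>m k = A ^\<^sub>m k"
    unfolding pow_mat_Suc_left[OF A] using dims by (simp add: mult_assoc_mat_dims)
  have "X * A * Y = X * A * A ^\<^sub>m k * Y ^\<^sub>m Suc k"
    using arg_cong[OF drazin_collapse[OF A Y(1-3), of k], of "\<lambda>M. X * A * M"] dims
    by (simp add: mult_assoc_mat_dims)
  also have "\<dots> = Y" unfolding XAk using drazin_collapse[OF A Y(1-3), of k] by simp
  finally have XAY: "X * A * Y = Y" .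
  have "X ^\<^sub>m Suc k * A = A * X ^\<^sub>m Suc k"
    by (rule pow_mat_intertwine[OF X(1) X(1) A X(3)[symmetric]])
  from pow_mat_intertwine[OF A A pow_carrier_mat[OF X(1)] this[symmetric], of k]
  have X_eq: "X = X ^\<^sub>m Suc k * A ^\<^sub>m k"
    using drazin_collapse[OF A X(1-3), of k] by simp
  have "X * A * Y = X ^\<^sub>m Suc k * (A ^\<^sub>m Suc k * Y)"
    using arg_cong[OF X_eq, of "\<lambda>M. M * A * Y"] dims by (simp add: mult_assoc_mat_dims)
  also have "\<dots> = X" unfolding Y(4) using X_eq by simp
  finally show ?thesis using XAY by simp
qed

lemma drazin_inverse:
  assumes A: "A \<in> carrier_mat n n"
  shows "drazin_inverse A \<in> carrier_mat n n"
    and "drazin_inverse A * A * drazin_inverse A = drazin_inverse A"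
    and "A * drazin_inverse A = drazin_inverse A * A"
    and "A ^\<^sub>m Suc (mat_index A) * drazin_inverse A = A ^\<^sub>m mat_index A"
proof -
  have "\<exists>!X. is_drazin_inverse A X"
    using is_drazin_inverse_exists[OF A] is_drazin_inverse_unique[OF A] by blast
  then have "is_drazin_inverse A (drazin_inverse A)"
    unfolding drazin_inverse_def is_drazin_inverse_def by (rule theI')
  then show "drazin_inverse A \<in> carrier_mat n n"
    and "drazin_inverse A * A * drazin_inverse A = drazin_inverse A"
    and "A * drazin_inverse A = drazin_inverse A * A"
    and "A ^\<^sub>m Suc (mat_index A) * drazin_inverse A = A ^\<^sub>m mat_index A"
    using A unfolding is_drazin_inverse_def by auto
qed

lemma drazin_inverse_range:
  assumes A: "A \<in> carrier_mat n n" and y: "y \<in> mat_range (drazin_inverse A)"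
  shows "y \<in> mat_range (A ^\<^sub>m j)"
proof -
  note D = drazin_inverse[OF A]
  obtain z where z: "z \<in> carrier_vec n" "y = drazin_inverse A *\<^sub>v z"
    using y carrier_matD[OF D(1)] by (auto simp: mat_range_def)
  have "y = (A ^\<^sub>m j * drazin_inverse A ^\<^sub>m Suc j) *\<^sub>v z"
    unfolding z(2) by (rule arg_cong[OF drazin_collapse[OF A D(1-3)], of "\<lambda>M. M *\<^sub>v z"])
  also have "\<dots> = A ^\<^sub>m j *\<^sub>v (drazin_inverse A ^\<^sub>m Suc j *\<^sub>v z)"
    by (rule assoc_mult_mat_vec[OF pow_carrier_mat[OF A] pow_carrier_mat[OF D(1)] z(1)])
  finally show ?thesis
    using mult_mat_vec_carrier[OF pow_carrier_mat[OF D(1)] z(1), of "Suc j"] carrier_matD[OF pow_carrier_mat[OF A]]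
    unfolding mat_range_def by auto
qed

text \<open>Since \<open>A\<^sup>D\<close> commutes with \<open>A\<close>, the identity \<open>A\<^sup>k\<^sup>+\<^sup>1 A\<^sup>D = A\<^sup>k\<close> also says that \<open>A A\<^sup>D\<close> fixes the range
of \<open>A\<^sup>k\<close>, the subspace over which the minimum is taken.\<close>

lemma drazin_inverse_on_core_range:
  assumes A: "A \<in> carrier_mat n n" and x: "x \<in> mat_range (A ^\<^sub>m mat_index A)"
  shows "drazin_inverse A *\<^sub>v (A *\<^sub>v x) = x"
    and "A *\<^sub>v (drazin_inverse A *\<^sub>v x) = x"
    and "drazin_inverse A *\<^sub>v x \<in> mat_range (A ^\<^sub>m mat_index A)"
proof -
  define k where "k = mat_index A"
  note D = drazin_inverse[OF A, folded k_def]
  have Ak: "A ^\<^sub>m k \<in> carrier_mat n n" using A by simp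
  note dims = carrier_matD[OF A] carrier_matD[OF D(1)] carrier_matD[OF Ak]
  obtain y where y: "y \<in> carrier_vec n" "x = A ^\<^sub>m k *\<^sub>v y"
    using x dims unfolding mat_range_def k_def by auto
  have com: "A ^\<^sub>m k * drazin_inverse A = drazin_inverse A * A ^\<^sub>m k"
    by (rule pow_mat_intertwine[OF A A D(1,3)])
  have "A * (drazin_inverse A * A ^\<^sub>m k) = A ^\<^sub>m Suc k * drazin_inverse A"
    unfolding com[symmetric] pow_mat_Suc_left[OF A] using dims by (simp add: mult_assoc_mat_dims)
  then have AD: "A * (drazin_inverse A * A ^\<^sub>m k) = A ^\<^sub>m k" using D(4) by simp
  then have "A * (drazin_inverse A * A ^\<^sub>m k) *\<^sub>v y = x" using y by simp
  then show 2: "A *\<^sub>v (drazin_inverse A *\<^sub>v x) = x"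
    using y dims by (simp add: mult_assoc_mat_vec_dims)
  have xc: "x \<in> carrier_vec n" using y Ak by simp
  have "A *\<^sub>v (drazin_inverse A *\<^sub>v x) = A * drazin_inverse A *\<^sub>v x"
    using xc dims by (simp add: mult_assoc_mat_vec_dims)
  also have "\<dots> = drazin_inverse A *\<^sub>v (A *\<^sub>v x)"
    unfolding D(3) using xc dims by (simp add: mult_assoc_mat_vec_dims)
  finally show "drazin_inverse A *\<^sub>v (A *\<^sub>v x) = x" using 2 by simp
  have "drazin_inverse A *\<^sub>v x = drazin_inverse A * A ^\<^sub>m k *\<^sub>v y"
    using y dims by (simp add: mult_assoc_mat_vec_dims)
  also have "\<dots> = A ^\<^sub>m k *\<^sub>v (drazin_inverse A *\<^sub>v y)"
    unfolding com[symmetric] using y dims by (simp add: mult_assoc_mat_vec_dims)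
  finally have eq: "drazin_inverse A *\<^sub>v x = A ^\<^sub>m k *\<^sub>v (drazin_inverse A *\<^sub>v y)" .
  have "drazin_inverse A *\<^sub>v y \<in> carrier_vec n" using D(1) y by simp
  then show "drazin_inverse A *\<^sub>v x \<in> mat_range (A ^\<^sub>m mat_index A)"
    unfolding eq mat_range_def k_def[symmetric] dims by blast
qed

section \<open>Moore--Penrose and Minkowski inverses\<close>

text \<open>Penrose's uniqueness proof uses of the adjoint only that it reverses products. The Moore--Penrose
inverse is the case of the conjugate transpose, the Minkowski inverse that of the Minkowski adjoint.\<close>

lemma penrose_unique:
  fixes adj :: "complex mat \<Rightarrow> complex mat"
  assumes A: "A \<in> carrier_mat n n" and X: "X \<in> carrier_mat n n" and Y: "Y \<in> carrier_mat n n"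
    and adj_mult: "\<And>M N. M \<in> carrier_mat n n \<Longrightarrow> N \<in> carrier_mat n n \<Longrightarrow> adj (M * N) = adj N * adj M"
    and pX: "A * X * A = A" "X * A * X = X" "adj (A * X) = A * X" "adj (X * A) = X * A"
    and pY: "A * Y * A = A" "Y * A * Y = Y" "adj (A * Y) = A * Y" "adj (Y * A) = Y * A"
  shows "X = Y"
proof -
  note dims = carrier_matD[OF A] carrier_matD[OF X] carrier_matD[OF Y]
  have c: "A * X \<in> carrier_mat n n" "A * Y \<in> carrier_mat n n" "X * A \<in> carrier_mat n n"
    "Y * A \<in> carrier_mat n n" using A X Y by auto
  have "A * X = A * Y * A * X" unfolding pY(1) ..
  also have "\<dots> = A * Y * (A * X)" using dims by (simp add: mult_assoc_mat_dims)
  finally have "A * X = A * Y * (A * X)" .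
  then have "A * X = A * X * (A * Y)" using adj_mult[OF c(2,1)] pX(3) pY(3) by simp
  also have "\<dots> = A * X * A * Y" using dims by (simp add: mult_assoc_mat_dims)
  finally have AX: "A * X = A * Y" unfolding pX(1) .
  have "Y * A = Y * (A * X * A)" unfolding pX(1) ..
  also have "\<dots> = Y * A * (X * A)" using dims by (simp add: mult_assoc_mat_dims)
  finally have "Y * A = Y * A * (X * A)" .
  then have "Y * A = X * A * (Y * A)" using adj_mult[OF c(4,3)] pX(4) pY(4) by simp
  also have "\<dots> = X * (A * Y * A)" using dims by (simp add: mult_assoc_mat_dims)
  finally have XA: "Y * A = X * A" unfolding pY(1) .
  have "X = X * (A * X)" using pX(2) dims by (simp add: mult_assoc_mat_dims)
  also have "\<dots> = X * A * Y" unfolding AX using dims by (simp add: mult_assoc_mat_dims)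
  also have "\<dots> = Y" unfolding XA[symmetric] pY(2) ..
  finally show ?thesis .
qed

lemma mat_adjoint_dims [simp]:
  "dim_row (mat_adjoint A) = dim_col A" "dim_col (mat_adjoint A) = dim_row A"
  by (simp_all add: mat_adjoint_def)

lemma mat_adjoint_carrier [simp]: "A \<in> carrier_mat n m \<Longrightarrow> mat_adjoint A \<in> carrier_mat m n"
  by (rule carrier_matI) (simp_all add: carrier_matD)

lemma mat_adjoint_index:
  fixes A :: "complex mat"
  shows "i < dim_col A \<Longrightarrow> j < dim_row A \<Longrightarrow> mat_adjoint A $$ (i, j) = cnj (A $$ (j, i))"
  by (simp add: mat_adjoint_def mat_of_rows_def)

lemma mat_adjoint_adjoint [simp]: "mat_adjoint (mat_adjoint A) = (A :: complex mat)"
  by (rule eq_matI) (auto simp: mat_adjoint_index)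

lemma mat_adjoint_one [simp]: "mat_adjoint (1\<^sub>m n) = (1\<^sub>m n :: complex mat)"
  by (rule eq_matI) (auto simp: mat_adjoint_index)

lemma mat_adjoint_mult:
  fixes A B :: "complex mat"
  assumes "dim_col A = dim_row B"
  shows "mat_adjoint (A * B) = mat_adjoint B * mat_adjoint A"
  using assms by (intro eq_matI) (auto simp: mat_adjoint_index scalar_prod_def mult.commute intro!: sum.cong)

lemma mat_adjoint_inverse:
  fixes D :: "complex mat"
  assumes D: "D \<in> carrier_mat r r" and E: "E \<in> carrier_mat r r" and DE: "D * E = 1\<^sub>m r"
    and herm: "mat_adjoint D = D"
  shows "mat_adjoint E = E"
proof -
  have ED: "E * D = 1\<^sub>m r" by (rule mat_mult_left_right_inverse[OF D E DE])
  have "mat_adjoint E * D = 1\<^sub>m r"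
    using arg_cong[OF DE, of mat_adjoint] herm D E by (simp add: mat_adjoint_mult)
  then have "mat_adjoint E * D * E = E" using E by simp
  then show ?thesis using D E DE by (simp add: mult_assoc_mat_dims)
qed

lemma mat_adjoint_diag_real:
  "mat_adjoint (mat_diag n (\<lambda>i. complex_of_real (f i))) = mat_diag n (\<lambda>i. complex_of_real (f i))"
  by (rule eq_matI) (auto simp: mat_adjoint_index mat_diag_def)

lemma minkowski_metric_carrier [simp]: "minkowski_metric n \<in> carrier_mat n n"
  by (simp add: minkowski_metric_def)

lemma minkowski_metric_adjoint: "mat_adjoint (minkowski_metric n) = minkowski_metric n"
  by (rule eq_matI) (auto simp: mat_adjoint_index minkowski_metric_def mat_diag_def)

lemma minkowski_metric_square: "minkowski_metric n * minkowski_metric n = 1\<^sub>m n"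
  unfolding minkowski_metric_def mat_diag_diag by (rule eq_matI) (auto simp: mat_diag_def)

lemma minkowski_metric_cancel:
  assumes "dim_row X = n"
  shows "minkowski_metric n * (minkowski_metric n * X) = X"
proof -
  have "minkowski_metric n * (minkowski_metric n * X) = minkowski_metric n * minkowski_metric n * X"
    using assms carrier_matD[OF minkowski_metric_carrier, of n] by (simp add: mult_assoc_mat_dims)
  also have "\<dots> = X"
    unfolding minkowski_metric_square using assms by (intro left_mult_one_mat) auto
  finally show ?thesis .
qed

lemma minkowski_adjoint_eq:
  "A \<in> carrier_mat n n \<Longrightarrow> minkowski_adjoint A = minkowski_metric n * mat_adjoint A * minkowski_metric n"
  by (simp add: minkowski_adjoint_def)

lemma minkowski_adjoint_mult:
  assumes A: "A \<in> carrier_mat n n" and B: "B \<in> carrier_mat n n"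
  shows "minkowski_adjoint (A * B) = minkowski_adjoint B * minkowski_adjoint A"
  using A B carrier_matD[OF minkowski_metric_carrier, of n]
  by (simp add: minkowski_adjoint_def mat_adjoint_mult mult_assoc_mat_dims minkowski_metric_cancel)

lemma moore_penrose_inverse_eqI:
  assumes A: "A \<in> carrier_mat n n" and X: "X \<in> carrier_mat n n"
    and "A * X * A = A" "X * A * X = X" "mat_adjoint (A * X) = A * X" "mat_adjoint (X * A) = X * A"
  shows "moore_penrose_inverse A = X"
  unfolding moore_penrose_inverse_def
proof (rule the_equality)
  fix Y assume "Y \<in> carrier_mat (dim_col A) (dim_row A) \<and> A * Y * A = A \<and> Y * A * Y = Y \<and>
    mat_adjoint (A * Y) = A * Y \<and> mat_adjoint (Y * A) = Y * A"
  with A have Y: "Y \<in> carrier_mat n n" "A * Y * A = A" "Y * A * Y = Y"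
    "mat_adjoint (A * Y) = A * Y" "mat_adjoint (Y * A) = Y * A" by auto
  have mult: "mat_adjoint (M * N) = mat_adjoint N * mat_adjoint M"
    if "M \<in> carrier_mat n n" "N \<in> carrier_mat n n" for M N :: "complex mat"
    by (rule mat_adjoint_mult) (use that in simp)
  show "Y = X" by (rule penrose_unique[OF A Y(1) X mult Y(2-5) assms(3-6)])
qed (use assms in auto)

lemma minkowski_inverse_eqI:
  assumes A: "A \<in> carrier_mat n n" and X: "X \<in> carrier_mat n n"
    and "A * X * A = A" "X * A * X = X"
      "minkowski_adjoint (A * X) = A * X" "minkowski_adjoint (X * A) = X * A"
  shows "minkowski_inverse A = X"
  unfolding minkowski_inverse_def
proof (rule the_equality)
  fix Y assume "Y \<in> carrier_mat (dim_row A) (dim_row A) \<and> A * Y * A = A \<and> Y * A * Y = Y \<and>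
    minkowski_adjoint (A * Y) = A * Y \<and> minkowski_adjoint (Y * A) = Y * A"
  with A have Y: "Y \<in> carrier_mat n n" "A * Y * A = A" "Y * A * Y = Y"
    "minkowski_adjoint (A * Y) = A * Y" "minkowski_adjoint (Y * A) = Y * A" by auto
  have mult: "minkowski_adjoint (M * N) = minkowski_adjoint N * minkowski_adjoint M"
    if "M \<in> carrier_mat n n" "N \<in> carrier_mat n n" for M N :: "complex mat"
    by (rule minkowski_adjoint_mult[OF that])
  show "Y = X" by (rule penrose_unique[OF A Y(1) X mult Y(2-5) assms(3-6)])
qed (use assms in auto)

section \<open>The Euclidean norm\<close>

lemma fnorm_conv_scalar_prod: "complex_of_real ((fnorm v)\<^sup>2) = v \<bullet> conjugate v"
proof -
  have "(fnorm v)\<^sup>2 = (\<Sum>i<dim_vec v. (cmod (v $ i))\<^sup>2)"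
    unfolding fnorm_def by (simp add: sum_nonneg)
  then have "complex_of_real ((fnorm v)\<^sup>2) = (\<Sum>i<dim_vec v. v $ i * cnj (v $ i))"
    by (simp only: of_real_sum complex_norm_square)
  also have "\<dots> = v \<bullet> conjugate v"
    by (simp add: scalar_prod_def lessThan_atLeast0)
  finally show ?thesis .
qed

lemma fnorm_nonneg [simp]: "0 \<le> fnorm v"
  unfolding fnorm_def by (simp add: sum_nonneg)

lemma fnorm_isometry:
  assumes W: "W \<in> carrier_mat n m" and iso: "mat_adjoint W * W = 1\<^sub>m m" and v: "v \<in> carrier_vec m"
  shows "fnorm (W *\<^sub>v v) = fnorm v"
proof -
  have adj: "(mat_adjoint W *\<^sub>v x) \<bullet> conjugate v = x \<bullet> conjugate (W *\<^sub>v v)" if x: "x \<in> carrier_vec n" for x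
  proof -
    let ?C = "map_mat cnj W"
    have C: "?C \<in> carrier_mat n m" using W by simp
    have "conjugate (W *\<^sub>v v) = ?C *\<^sub>v conjugate v"
      using W v by (intro eq_vecI) (auto simp: scalar_prod_def)
    moreover have "mat_adjoint W = ?C\<^sup>T"
      using W by (intro eq_matI) (auto simp: mat_adjoint_index)
    ultimately show ?thesis using transpose_vec_mult_scalar[OF C _ x, of "conjugate v"] v by simp
  qed
  have "complex_of_real ((fnorm (W *\<^sub>v v))\<^sup>2) = (mat_adjoint W *\<^sub>v (W *\<^sub>v v)) \<bullet> conjugate v"
    unfolding fnorm_conv_scalar_prod using W v by (subst adj) auto
  also have "mat_adjoint W *\<^sub>v (W *\<^sub>v v) = v"
    using arg_cong[OF iso, of "\<lambda>M. M *\<^sub>v v"] W v by (simp add: mult_assoc_mat_vec_dims)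
  finally have "(fnorm (W *\<^sub>v v))\<^sup>2 = (fnorm v)\<^sup>2"
    unfolding fnorm_conv_scalar_prod[symmetric] of_real_eq_iff .
  then show ?thesis by simp
qed

lemma fnorm_append: "(fnorm (u @\<^sub>v w))\<^sup>2 = (fnorm u)\<^sup>2 + (fnorm w)\<^sup>2"
proof -
  have "conjugate (u @\<^sub>v w) = conjugate u @\<^sub>v conjugate w" by (intro eq_vecI) auto
  then have "complex_of_real ((fnorm (u @\<^sub>v w))\<^sup>2) =
      (u @\<^sub>v w) \<bullet> (conjugate u @\<^sub>v conjugate w)"
    unfolding fnorm_conv_scalar_prod by simp
  also have "\<dots> = u \<bullet> conjugate u + w \<bullet> conjugate w"
    by (rule scalar_prod_append[of u "dim_vec u" w "dim_vec w"]) auto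
  finally have "complex_of_real ((fnorm (u @\<^sub>v w))\<^sup>2) =
      complex_of_real ((fnorm u)\<^sup>2 + (fnorm w)\<^sup>2)"
    unfolding of_real_add fnorm_conv_scalar_prod .
  then show ?thesis unfolding of_real_eq_iff .
qed

lemma fnorm_uminus: "fnorm (- v) = fnorm v"
  unfolding fnorm_def by simp

lemma fnorm_eq_0D:
  assumes "fnorm v = 0"
  shows "v = 0\<^sub>v (dim_vec v)"
proof (rule eq_vecI)
  fix i assume "i < dim_vec (0\<^sub>v (dim_vec v) :: complex vec)"
  moreover have "(\<Sum>i<dim_vec v. (cmod (v $ i))\<^sup>2) = 0"
    using assms unfolding fnorm_def by simp
  ultimately show "v $ i = 0\<^sub>v (dim_vec v) $ i"
    by (subst (asm) sum_nonneg_eq_0_iff) auto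
qed simp

section \<open>Inverses from full rank factorizations\<close>

text \<open>A cancellation rule for products associated to the right, the normal form of
\<open>mult_assoc_mat_dims\<close>.\<close>

lemma mult_cancel_left_dims:
  fixes A :: "'a::semiring_1 mat"
  assumes "A * B = 1\<^sub>m r" "dim_col A = dim_row B" "dim_col B = dim_row Y" "dim_row Y = r"
  shows "A * (B * Y) = Y"
proof -
  have "A * (B * Y) = A * B * Y"
    by (rule mult_assoc_mat_dims[symmetric]) (use assms in simp_all)
  also have "\<dots> = Y" unfolding assms(1) using assms(4) by (intro left_mult_one_mat) auto
  finally show ?thesis .
qed

text \<open>When the left factor of a full rank factorization has orthonormal columns, the projection onto the
range is \<open>F F\<^sup>*\<close>; the matrix \<open>E\<close> is the inverse of the Gram matrix \<open>H H\<^sup>*\<close>.\<close>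

lemma moore_penrose_of_full_rank_factorization:
  assumes F: "F \<in> carrier_mat n r" and H: "H \<in> carrier_mat r n" and E: "E \<in> carrier_mat r r"
    and FF: "mat_adjoint F * F = 1\<^sub>m r" and HE: "H * mat_adjoint H * E = 1\<^sub>m r"
  shows "moore_penrose_inverse (F * H) = mat_adjoint H * E * mat_adjoint F"
    and "F * H * moore_penrose_inverse (F * H) = F * mat_adjoint F"
proof -
  note dims = carrier_matD[OF F] carrier_matD[OF H] carrier_matD[OF E]
  let ?X = "mat_adjoint H * E * mat_adjoint F"
  have HH: "H * mat_adjoint H \<in> carrier_mat r r" using H by simp
  have E_herm: "mat_adjoint E = E"
    by (rule mat_adjoint_inverse[OF HH E HE]) (use dims in \<open>simp add: mat_adjoint_mult\<close>)
  have cF: "mat_adjoint F * (F * Y) = Y" if "dim_row Y = r" for Y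
    using mult_cancel_left_dims[OF FF] that dims by simp
  have cH: "H * (mat_adjoint H * (E * Y)) = Y" if "dim_row Y = r" for Y
    using mult_cancel_left_dims[OF HE, of Y] that dims by (simp add: mult_assoc_mat_dims)
  have AX: "F * H * ?X = F * mat_adjoint F"
    using dims by (simp add: mult_assoc_mat_dims cH)
  have XA: "?X * (F * H) = mat_adjoint H * (E * H)"
    using dims by (simp add: mult_assoc_mat_dims cF)
  show mp: "moore_penrose_inverse (F * H) = ?X"
  proof (rule moore_penrose_inverse_eqI)
    show "F * H * ?X * (F * H) = F * H" unfolding AX using dims by (simp add: mult_assoc_mat_dims cF)
    show "?X * (F * H) * ?X = ?X" unfolding XA using dims by (simp add: mult_assoc_mat_dims cH)
    show "mat_adjoint (F * H * ?X) = F * H * ?X" unfolding AX using dims by (simp add: mat_adjoint_mult)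
    show "mat_adjoint (?X * (F * H)) = ?X * (F * H)"
      unfolding XA using dims E_herm by (simp add: mat_adjoint_mult mult_assoc_mat_dims)
  qed (use F H E in auto)
  show "F * H * moore_penrose_inverse (F * H) = F * mat_adjoint F" unfolding mp by (rule AX)
qed

text \<open>The same formula with the indefinite inner product given by \<open>G\<close>. Here the Gram matrices
\<open>F\<^sup>* G F\<close> and \<open>H G H\<^sup>*\<close> may be singular, and their inverses \<open>D\<close> and \<open>N\<close> have to be given.\<close>

lemma minkowski_inverse_of_full_rank_factorization:
  fixes n :: nat
  defines "G \<equiv> minkowski_metric n"
  assumes F: "F \<in> carrier_mat n r" and H: "H \<in> carrier_mat r n"
    and D: "D \<in> carrier_mat r r" and N: "N \<in> carrier_mat r r"
    and FD: "mat_adjoint F * G * F * D = 1\<^sub>m r" and HN: "H * G * mat_adjoint H * N = 1\<^sub>m r"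
  shows "minkowski_inverse (F * H) = G * mat_adjoint H * N * D * mat_adjoint F * G"
    and "F * H * minkowski_inverse (F * H) = F * D * mat_adjoint F * G"
proof -
  have G: "G \<in> carrier_mat n n" unfolding G_def by simp
  note dims = carrier_matD[OF F] carrier_matD[OF H] carrier_matD[OF D] carrier_matD[OF N] carrier_matD[OF G]
  let ?X = "G * mat_adjoint H * N * D * mat_adjoint F * G"
  have G_herm: "mat_adjoint G = G" unfolding G_def by (rule minkowski_metric_adjoint)
  have cG: "G * (G * Y) = Y" if "dim_row Y = n" for Y
    unfolding G_def using that by (rule minkowski_metric_cancel)
  have FGF: "mat_adjoint F * G * F \<in> carrier_mat r r" and HGH: "H * G * mat_adjoint H \<in> carrier_mat r r"
    using F G H by auto
  have DF: "D * (mat_adjoint F * G * F) = 1\<^sub>m r" by (rule mat_mult_left_right_inverse[OF FGF D FD])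
  have D_herm: "mat_adjoint D = D"
    by (rule mat_adjoint_inverse[OF FGF D FD])
      (use dims G_herm in \<open>simp add: mat_adjoint_mult mult_assoc_mat_dims\<close>)
  have N_herm: "mat_adjoint N = N"
    by (rule mat_adjoint_inverse[OF HGH N HN])
      (use dims G_herm in \<open>simp add: mat_adjoint_mult mult_assoc_mat_dims\<close>)
  have cF: "D * (mat_adjoint F * (G * (F * Y))) = Y" if "dim_row Y = r" for Y
    using mult_cancel_left_dims[OF DF, of Y] that dims by (simp add: mult_assoc_mat_dims)
  have cH: "H * (G * (mat_adjoint H * (N * Y))) = Y" if "dim_row Y = r" for Y
    using mult_cancel_left_dims[OF HN, of Y] that dims by (simp add: mult_assoc_mat_dims)
  have AX: "F * H * ?X = F * D * mat_adjoint F * G"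
    using dims by (simp add: mult_assoc_mat_dims cH)
  have XA: "?X * (F * H) = G * mat_adjoint H * N * H"
    using dims by (simp add: mult_assoc_mat_dims cF)
  show mk: "minkowski_inverse (F * H) = ?X"
  proof (rule minkowski_inverse_eqI)
    show FH: "F * H \<in> carrier_mat n n" using F H by simp
    show X: "?X \<in> carrier_mat n n" by (rule carrier_matI) (use dims in simp_all)
    show "F * H * ?X * (F * H) = F * H" unfolding AX using dims by (simp add: mult_assoc_mat_dims cF)
    show "?X * (F * H) * ?X = ?X" unfolding XA using dims by (simp add: mult_assoc_mat_dims cH)
    show "minkowski_adjoint (F * H * ?X) = F * H * ?X"
      unfolding minkowski_adjoint_eq[OF mult_carrier_mat[OF FH X], folded G_def] unfolding AX
      using dims D_herm G_herm by (simp add: mat_adjoint_mult mult_assoc_mat_dims cG)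
    show "minkowski_adjoint (?X * (F * H)) = ?X * (F * H)"
      unfolding minkowski_adjoint_eq[OF mult_carrier_mat[OF X FH], folded G_def] unfolding XA
      using dims N_herm G_herm
      by (simp add: mat_adjoint_mult mult_assoc_mat_dims right_mult_one_mat
          minkowski_metric_square[of n, folded G_def])
  qed
  show "F * H * minkowski_inverse (F * H) = F * D * mat_adjoint F * G" unfolding mk by (rule AX)
qed

lemma mat_inverse_eqI:
  fixes G :: "'a::field mat"
  assumes G: "G \<in> carrier_mat r r" and D: "D \<in> carrier_mat r r" and GD: "G * D = 1\<^sub>m r"
  shows "mat_inverse G = Some D"
proof (cases "mat_inverse G")
  case None
  have "D * G = 1\<^sub>m r" by (rule mat_mult_left_right_inverse[OF G D GD])
  then have "G \<in> Units (ring_mat TYPE('a) r ())"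
    using G D GD unfolding Units_def ring_mat_def by auto
  then show ?thesis using mat_inverse(1)[OF G None, where b = "()"] by blast
next
  case (Some B)
  have B: "B * G = 1\<^sub>m r" "B \<in> carrier_mat r r" using mat_inverse(2)[OF G Some] by auto
  have "B = B * (G * D)" unfolding GD using B(2) by simp
  also have "\<dots> = D" using mult_cancel_left_dims[OF B(1), of D] carrier_matD[OF B(2)]
    carrier_matD[OF G] carrier_matD[OF D] by simp
  finally show ?thesis using Some by simp
qed

section \<open>Blocks\<close>

lemma mat_adjoint_zero [simp]: "mat_adjoint (0\<^sub>m p q) = (0\<^sub>m q p :: complex mat)"
  by (rule eq_matI) (auto simp: mat_adjoint_index)

lemma mat_adjoint_four_block:
  fixes A :: "complex mat"
  assumes "A \<in> carrier_mat p q" "B \<in> carrier_mat p s" "C \<in> carrier_mat t q" "D \<in> carrier_mat t s"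
  shows "mat_adjoint (four_block_mat A B C D) =
    four_block_mat (mat_adjoint A) (mat_adjoint C) (mat_adjoint B) (mat_adjoint D)"
  using assms by (intro eq_matI) (auto simp: mat_adjoint_index)

text \<open>Multiplication by this matrix on the right takes the first \<open>r\<close> columns, multiplication by its
adjoint on the left takes the first \<open>r\<close> rows. In this way block decompositions become products of
matrices.\<close>

definition coord_embedding :: "nat \<Rightarrow> nat \<Rightarrow> complex mat" where
  "coord_embedding r m = mat (r + m) r (\<lambda>(i, j). if i = j then 1 else 0)"

lemma coord_embedding_carrier: "coord_embedding r m \<in> carrier_mat (r + m) r"
  by (simp add: coord_embedding_def)

lemma mult_coord_embedding:
  assumes "X \<in> carrier_mat p (r + m)"
  shows "X * coord_embedding r m = mat p r (\<lambda>(i, j). X $$ (i, j))"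
  using assms
  by (intro eq_matI) (auto simp: coord_embedding_def scalar_prod_def if_distrib[of "\<lambda>t. _ * t"] cong: if_cong)

lemma adjoint_coord_embedding_mult:
  assumes "X \<in> carrier_mat (r + m) p"
  shows "mat_adjoint (coord_embedding r m) * X = mat r p (\<lambda>(i, j). X $$ (i, j))"
proof -
  have "mat_adjoint (mat_adjoint X * coord_embedding r m) = mat r p (\<lambda>(i, j). X $$ (i, j))"
    unfolding mult_coord_embedding[OF mat_adjoint_carrier[OF assms]]
    using assms by (intro eq_matI) (auto simp: mat_adjoint_index)
  then show ?thesis
    using assms coord_embedding_carrier[of r m] by (simp add: mat_adjoint_mult)
qed

lemma coord_embedding_mult_vec:
  assumes "u \<in> carrier_vec r"
  shows "coord_embedding r m *\<^sub>v u = u @\<^sub>v 0\<^sub>v m"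
  using assms
  by (intro eq_vecI) (auto simp: coord_embedding_def scalar_prod_def if_distrib[of "\<lambda>t. t * _"] cong: if_cong)

lemma coord_embedding_isometry:
  "mat_adjoint (coord_embedding r m) * coord_embedding r m = 1\<^sub>m r"
  unfolding adjoint_coord_embedding_mult[OF coord_embedding_carrier]
  by (intro eq_matI) (auto simp: coord_embedding_def)

lemma adjoint_coord_embedding_append:
  assumes u: "u \<in> carrier_vec r" and w: "w \<in> carrier_vec m"
  shows "mat_adjoint (coord_embedding r m) *\<^sub>v (u @\<^sub>v w) = u"
proof (rule eq_vecI)
  fix i assume i: "i < dim_vec u"
  then have ir: "i < r" using u by simp
  have "row (mat_adjoint (coord_embedding r m)) i = unit_vec (r + m) i"
    using ir by (intro eq_vecI) (auto simp: mat_adjoint_index coord_embedding_def)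
  then show "(mat_adjoint (coord_embedding r m) *\<^sub>v (u @\<^sub>v w)) $ i = u $ i"
    using u w i ir coord_embedding_carrier[of r m] by (simp add: scalar_prod_left_unit)
qed (use u coord_embedding_carrier[of r m] in simp)

lemma corner_of_four_block:
  assumes "A \<in> carrier_mat r r" "B \<in> carrier_mat r m" "C \<in> carrier_mat m r" "D \<in> carrier_mat m m"
  shows "mat_adjoint (coord_embedding r m) * four_block_mat A B C D * coord_embedding r m = A"
proof -
  have "four_block_mat A B C D \<in> carrier_mat (r + m) (r + m)" using assms by simp
  from adjoint_coord_embedding_mult[OF this] mult_coord_embedding[of _ r r m]
  show ?thesis using assms by (intro eq_matI) auto
qed

text \<open>A matrix with vanishing lower blocks is fixed by the projection onto the first \<open>r\<close> coordinates.
This extracts a full rank factorization from the Hartwig--Spindelboeck form.\<close>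

lemma coord_embedding_upper_block:
  assumes "A \<in> carrier_mat r r" "B \<in> carrier_mat r m"
  defines "M \<equiv> four_block_mat A B (0\<^sub>m m r) (0\<^sub>m m m)"
  shows "coord_embedding r m * (mat_adjoint (coord_embedding r m) * M) = M"
proof -
  have M: "M \<in> carrier_mat (r + m) (r + m)" unfolding M_def using assms by simp
  show ?thesis
  proof (rule mat_col_eqI)
    fix j assume "j < dim_col M"
    then have j: "j < r + m" using M by simp
    define c where "c = vec r (\<lambda>i. M $$ (i, j))"
    have "col (mat_adjoint (coord_embedding r m) * M) j = c"
      unfolding adjoint_coord_embedding_mult[OF M] c_def using j by (intro eq_vecI) auto
    then have "col (coord_embedding r m * (mat_adjoint (coord_embedding r m) * M)) j = c @\<^sub>v 0\<^sub>v m"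
      using coord_embedding_mult_vec[of c r m] j M coord_embedding_carrier[of r m]
      by (subst col_mult2[of _ "r + m" r _ "r + m"]) (auto simp: c_def)
    also have "\<dots> = col M j"
      using j assms(1,2) by (intro eq_vecI) (auto simp: c_def M_def)
    finally show "col (coord_embedding r m * (mat_adjoint (coord_embedding r m) * M)) j = col M j" .
  qed (use M coord_embedding_carrier[of r m] in auto)
qed

section \<open>The minimization problem\<close>

theorem theorem5p2:
  fixes n r k :: nat
    and A U K L G G1 G2 G4 \<Sigma> :: "complex mat"
    and \<sigma> :: "nat \<Rightarrow> real"
    and b b1 b2 :: "complex vec"
  assumes A: "A \<in> carrier_mat n n"
    and k: "k = mat_index A"
    and r: "r = crank (minkowski_adjoint A * A * minkowski_adjoint A)"
    and rank: "r = crank A"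
    and r_less: "r < n"
    and U: "U \<in> carrier_mat n n" "unitary_mat U"
    and sigma_pos: "\<forall>i<r. 0 < \<sigma> i"
    and sigma_sv: "image_mset \<sigma> (mset_set {0..<r}) = {# s \<in># singular_values A. 0 < s #}"
    and Sigma: "\<Sigma> = mat_diag r (\<lambda>i. complex_of_real (\<sigma> i))"
    and K: "K \<in> carrier_mat r r"
    and L: "L \<in> carrier_mat r (n - r)"
    and KL: "K * mat_adjoint K + L * mat_adjoint L = 1\<^sub>m r"
    and A_eq: "A = U * four_block_mat (\<Sigma> * K) (\<Sigma> * L) (0\<^sub>m (n - r) r) (0\<^sub>m (n - r) (n - r))
                   * mat_adjoint U"
    and G: "G = minkowski_metric n"
    and G1: "G1 \<in> carrier_mat r r"
    and G2: "G2 \<in> carrier_mat r (n - r)"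
    and G4: "G4 \<in> carrier_mat (n - r) (n - r)"
    and G_eq: "G = U * four_block_mat G1 G2 (mat_adjoint G2) G4 * mat_adjoint U"
    and b1: "b1 \<in> carrier_vec r"
    and b1_range: "the (mat_inverse G1) *\<^sub>v b1 \<in> mat_range (drazin_inverse (\<Sigma> * K))"
    and b2: "b2 \<in> carrier_vec (n - r)"
    and b: "b = G * U *\<^sub>v (b1 @\<^sub>v b2)"
  shows "let f = (\<lambda>x. fnorm (minkowski_adjoint (A * moore_penrose_inverse A) * A *\<^sub>v x - b)) in
         (\<exists>x \<in> mat_range (A ^\<^sub>m k). f x = fnorm b2) \<and>
         (\<forall>x \<in> mat_range (A ^\<^sub>m k). fnorm b2 \<le> f x) \<and>
         (\<forall>x. is_arg_min f (\<lambda>x. x \<in> mat_range (A ^\<^sub>m k)) x \<longleftrightarrow> x = m_DMP_inverse A *\<^sub>v b)"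
proof -
  define m where "m = n - r"
  have n: "n = r + m" using r_less unfolding m_def by simp
  define J where "J = coord_embedding r m"
  define T where "T = four_block_mat (\<Sigma> * K) (\<Sigma> * L) (0\<^sub>m m r) (0\<^sub>m m m)"
  define F where "F = U * J"
  define H where "H = mat_adjoint J * T * mat_adjoint U"
  have S: "\<Sigma> \<in> carrier_mat r r" unfolding Sigma by simp
  have L': "L \<in> carrier_mat r m" and G2': "G2 \<in> carrier_mat r m" and G4': "G4 \<in> carrier_mat m m"
    and b2': "b2 \<in> carrier_vec m" using L G2 G4 b2 unfolding m_def by auto
  have SK: "\<Sigma> * K \<in> carrier_mat r r" and SL: "\<Sigma> * L \<in> carrier_mat r m"
    using S K L' by auto
  have Gc: "G \<in> carrier_mat n n" unfolding G by simp
  have J: "J \<in> carrier_mat n r" unfolding J_def n by (rule coord_embedding_carrier)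
  have T: "T \<in> carrier_mat n n" unfolding T_def n using SK SL by simp
  have F: "F \<in> carrier_mat n r" and H: "H \<in> carrier_mat r n"
    unfolding F_def H_def using U(1) J T by auto
  note dims = carrier_matD[OF A] carrier_matD[OF U(1)] carrier_matD[OF Gc] carrier_matD[OF J]
    carrier_matD[OF T] carrier_matD[OF F] carrier_matD[OF H] carrier_matD[OF S] carrier_matD[OF K]
    carrier_matD[OF L'] carrier_matD[OF G1]

  have UU: "mat_adjoint U * U = 1\<^sub>m n" using U unfolding unitary_mat_def by auto
  have cU: "mat_adjoint U * (U * Y) = Y" if "dim_row Y = n" for Y
    using mult_cancel_left_dims[OF UU] that dims by simp
  have FF: "mat_adjoint F * F = 1\<^sub>m r"
    unfolding F_def using dims coord_embedding_isometry[of r m, folded J_def]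
    by (simp add: mat_adjoint_mult mult_assoc_mat_dims cU)
  have JTJ: "mat_adjoint J * (T * J) = \<Sigma> * K"
    using corner_of_four_block[OF SK SL, of "0\<^sub>m m r" "0\<^sub>m m m"] dims
    unfolding T_def[symmetric] J_def[symmetric] by (simp add: mult_assoc_mat_dims)
  have HF: "H * F = \<Sigma> * K"
    unfolding F_def H_def using dims by (simp add: mult_assoc_mat_dims cU JTJ)
  have "F * H = U * (J * (mat_adjoint J * T)) * mat_adjoint U"
    unfolding F_def H_def using dims by (simp add: mult_assoc_mat_dims)
  also have "J * (mat_adjoint J * T) = T"
    unfolding J_def T_def by (rule coord_embedding_upper_block[OF SK SL])
  also have "U * T * mat_adjoint U = A" unfolding A_eq T_def m_def ..
  finally have A_FH: "A = F * H" by simp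

  have G1_eq: "mat_adjoint F * G * F = G1"
  proof -
    define B where "B = four_block_mat G1 G2 (mat_adjoint G2) G4"
    have B: "B \<in> carrier_mat n n" unfolding B_def n using G1 G2' G4' by simp
    have "mat_adjoint F * G * F = mat_adjoint J * B * J"
      unfolding F_def G_eq B_def[symmetric] using dims carrier_matD[OF B]
      by (simp add: mat_adjoint_mult mult_assoc_mat_dims cU)
    also have "\<dots> = G1"
      unfolding B_def J_def using G1 G2' G4' by (intro corner_of_four_block) auto
    finally show ?thesis .
  qed

  \<comment> \<open>The inverse of \<open>H H\<^sup>* = \<Sigma>\<^sup>2\<close>.\<close>
  define E where "E = mat_diag r (\<lambda>i. complex_of_real (1 / (\<sigma> i)\<^sup>2))"
  have E: "E \<in> carrier_mat r r" unfolding E_def by simp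
  have S_adj: "mat_adjoint \<Sigma> = \<Sigma>" unfolding Sigma by (rule mat_adjoint_diag_real)
  have HH: "H * mat_adjoint H = \<Sigma> * \<Sigma>"
  proof -
    define P where "P = (\<Sigma> * K) * mat_adjoint (\<Sigma> * K) + (\<Sigma> * L) * mat_adjoint (\<Sigma> * L)"
    have P: "P \<in> carrier_mat r r" unfolding P_def using SK SL by auto
    have TT: "T * mat_adjoint T = four_block_mat P (0\<^sub>m r m) (0\<^sub>m m r) (0\<^sub>m m m)"
      unfolding T_def P_def using SK SL mat_adjoint_carrier[OF SK] mat_adjoint_carrier[OF SL]
      by (subst mat_adjoint_four_block[of _ r r _ m _ m])
        (auto simp: mult_four_block_mat[of _ r r _ m _ m _ _ r _ m]
          right_mult_zero_mat[OF SK, of m] right_mult_zero_mat[OF SL, of m]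
          left_mult_zero_mat[OF mat_adjoint_carrier[OF SK], of m]
          left_mult_zero_mat[OF mat_adjoint_carrier[OF SL], of m])
    have "H * mat_adjoint H = mat_adjoint J * (T * mat_adjoint T) * J"
      unfolding H_def using dims by (simp add: mat_adjoint_mult mult_assoc_mat_dims cU)
    also have "\<dots> = P"
      unfolding TT J_def using P by (intro corner_of_four_block) auto
    also have "\<dots> = \<Sigma> * (K * mat_adjoint K) * \<Sigma> + \<Sigma> * (L * mat_adjoint L) * \<Sigma>"
      unfolding P_def using dims S_adj by (simp add: mat_adjoint_mult mult_assoc_mat_dims)
    also have "\<dots> = (\<Sigma> * (K * mat_adjoint K) + \<Sigma> * (L * mat_adjoint L)) * \<Sigma>"
      using S K L' by (intro add_mult_distrib_mat[symmetric, of _ r r]) auto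
    also have "\<Sigma> * (K * mat_adjoint K) + \<Sigma> * (L * mat_adjoint L) =
        \<Sigma> * (K * mat_adjoint K + L * mat_adjoint L)"
      using S K L' by (intro mult_add_distrib_mat[symmetric, of _ r r _ r]) auto
    also have "\<dots> = \<Sigma>" unfolding KL using S by simp
    finally show ?thesis .
  qed
  have HE: "H * mat_adjoint H * E = 1\<^sub>m r"
    unfolding HH Sigma E_def mat_diag_diag using sigma_pos
    by (intro eq_matI) (auto simp: mat_diag_def power2_eq_square)

  have Gs: "G * (G * Y) = Y" if "dim_row Y = n" for Y
    unfolding G using that by (rule minkowski_metric_cancel)
  have G_herm: "mat_adjoint G = G" unfolding G by (rule minkowski_metric_adjoint)
  \<comment> \<open>\<open>A\<^sup>\<sim> A A\<^sup>\<sim>\<close> has \<open>G1\<close> and the other Gram matrix \<open>M\<close> as inner factors, so that its rank forces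
    both to be nonsingular.\<close>
  have A_adj: "minkowski_adjoint A = G * mat_adjoint H * mat_adjoint F * G"
    unfolding minkowski_adjoint_eq[OF A] G[symmetric] unfolding A_FH
    using dims by (simp add: mat_adjoint_mult mult_assoc_mat_dims)
  define M where "M = H * G * mat_adjoint H"
  have M: "M \<in> carrier_mat r r" unfolding M_def using H Gc by auto
  have rank_M: "vec_space.rank n (minkowski_adjoint A * A * minkowski_adjoint A) = r"
    using r A_adj dims by simp
  have AAA: "minkowski_adjoint A * A * minkowski_adjoint A =
      G * mat_adjoint H * G1 * (M * (mat_adjoint F * G))"
    unfolding A_adj unfolding A_FH M_def G1_eq[symmetric]
    using dims by (simp add: mult_assoc_mat_dims)
  have AAA': "G * mat_adjoint H * G1 * (M * (mat_adjoint F * G)) =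
      G * mat_adjoint H * G1 * M * (mat_adjoint F * G)"
    using dims carrier_matD[OF M] by (simp add: mult_assoc_mat_dims)
  have X1: "G * mat_adjoint H \<in> carrier_mat n r" and X2: "G * mat_adjoint H * G1 \<in> carrier_mat n r"
    and Y1: "M * (mat_adjoint F * G) \<in> carrier_mat r n" and Y2: "mat_adjoint F * G \<in> carrier_mat r n"
    by (auto intro!: carrier_matI simp: dims carrier_matD[OF M])
  obtain D where D: "D \<in> carrier_mat r r" "G1 * D = 1\<^sub>m r" "D * G1 = 1\<^sub>m r"
    using full_rank_product_middle_inverse[OF X1 G1 Y1] rank_M unfolding AAA by blast
  obtain N where N: "N \<in> carrier_mat r r" "M * N = 1\<^sub>m r"
    using full_rank_product_middle_inverse[OF X2 M Y2] rank_M unfolding AAA AAA' by blast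
  have D_eq: "the (mat_inverse G1) = D" using mat_inverse_eqI[OF G1 D(1,2)] by simp

  have AMP: "A * moore_penrose_inverse A = F * mat_adjoint F"
    unfolding A_FH by (rule moore_penrose_of_full_rank_factorization(2)[OF F H E FF HE])
  have AMink: "A * minkowski_inverse A = F * D * mat_adjoint F * G"
    unfolding A_FH G
    by (rule minkowski_inverse_of_full_rank_factorization(2)[OF F H D(1) N(1)])
      (use D N G1_eq M_def G in auto)

  \<comment> \<open>In the coordinates \<open>F\<close> of the range of \<open>A\<close>, the vector \<open>c\<close> is the value that \<open>A x\<close> must have.\<close>
  define c where "c = D *\<^sub>v b1"
  have c: "c \<in> carrier_vec r" unfolding c_def using D(1) b1 by simp
  have bb: "b1 @\<^sub>v b2 \<in> carrier_vec n" unfolding n using b1 b2' by simp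
  define W where "W = G * U"
  have W: "W \<in> carrier_mat n n" unfolding W_def using Gc U(1) by simp
  have WW: "mat_adjoint W * W = 1\<^sub>m n"
    unfolding W_def using dims G_herm UU by (simp add: mat_adjoint_mult mult_assoc_mat_dims Gs)

  define f where "f = (\<lambda>x. fnorm (minkowski_adjoint (A * moore_penrose_inverse A) * A *\<^sub>v x - b))"
  have f_sq: "(f x)\<^sup>2 = (fnorm (G1 *\<^sub>v (H *\<^sub>v x) - b1))\<^sup>2 + (fnorm b2)\<^sup>2"
    if x: "x \<in> carrier_vec n" for x
  proof -
    define y where "y = G1 *\<^sub>v (H *\<^sub>v x)"
    have y: "y \<in> carrier_vec r" unfolding y_def using G1 H x by simp
    \<comment> \<open>\<open>(F F\<^sup>*)\<^sup>\<sim> F H = G F F\<^sup>* G F H\<close>, with \<open>F = U J\<close> and \<open>F\<^sup>* G F = G1\<close>.\<close>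
    have "minkowski_adjoint (A * moore_penrose_inverse A) * A = W * (J * (G1 * H))"
    proof -
      have "F * mat_adjoint F \<in> carrier_mat n n" using F by simp
      from minkowski_adjoint_eq[OF this, folded G]
      show ?thesis unfolding AMP unfolding A_FH G1_eq[symmetric] W_def
        using dims by (simp add: mat_adjoint_mult mult_assoc_mat_dims F_def)
    qed
    then have "minkowski_adjoint (A * moore_penrose_inverse A) * A *\<^sub>v x = W *\<^sub>v (J *\<^sub>v y)"
      unfolding y_def using dims carrier_matD[OF W] x by (simp add: mult_assoc_mat_vec_dims)
    also have "J *\<^sub>v y = y @\<^sub>v 0\<^sub>v m" unfolding J_def by (rule coord_embedding_mult_vec[OF y])
    finally have "minkowski_adjoint (A * moore_penrose_inverse A) * A *\<^sub>v x - b =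
        W *\<^sub>v ((y @\<^sub>v 0\<^sub>v m) - (b1 @\<^sub>v b2))"
      unfolding b W_def[symmetric] using y n
      by (subst mult_minus_distrib_mat_vec[OF W _ bb]) auto
    also have "(y @\<^sub>v 0\<^sub>v m) - (b1 @\<^sub>v b2) = (y - b1) @\<^sub>v (- b2)"
      using y b1 b2' by (intro eq_vecI) auto
    finally have "f x = fnorm (W *\<^sub>v ((y - b1) @\<^sub>v (- b2)))" unfolding f_def by simp
    also have "\<dots> = fnorm ((y - b1) @\<^sub>v (- b2))"
      by (rule fnorm_isometry[OF W WW]) (use y b1 b2' n in auto)
    finally show ?thesis unfolding y_def by (simp add: fnorm_append fnorm_uminus)
  qed
  have f_ge: "fnorm b2 \<le> f x" if "x \<in> carrier_vec n" for x
    by (rule power2_le_imp_le) (use f_sq[OF that] in \<open>auto simp: f_def\<close>)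
  have f_eq: "f x = fnorm b2 \<longleftrightarrow> H *\<^sub>v x = c" if x: "x \<in> carrier_vec n" for x
  proof -
    have Hx: "H *\<^sub>v x \<in> carrier_vec r" using H x by simp
    have v: "G1 *\<^sub>v (H *\<^sub>v x) \<in> carrier_vec r" using G1 Hx by simp
    have "f x = fnorm b2 \<longleftrightarrow> (f x)\<^sup>2 = (fnorm b2)\<^sup>2" by (simp add: f_def)
    also have "\<dots> \<longleftrightarrow> fnorm (G1 *\<^sub>v (H *\<^sub>v x) - b1) = 0" unfolding f_sq[OF x] by simp
    also have "\<dots> \<longleftrightarrow> G1 *\<^sub>v (H *\<^sub>v x) = b1"
    proof
      assume "fnorm (G1 *\<^sub>v (H *\<^sub>v x) - b1) = 0"
      from fnorm_eq_0D[OF this] have 0: "G1 *\<^sub>v (H *\<^sub>v x) - b1 = 0\<^sub>v r" using b1 by simp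
      show "G1 *\<^sub>v (H *\<^sub>v x) = b1"
      proof (rule eq_vecI)
        fix i assume i: "i < dim_vec b1"
        then have "(G1 *\<^sub>v (H *\<^sub>v x) - b1) $ i = 0" unfolding 0 using b1 by simp
        then show "(G1 *\<^sub>v (H *\<^sub>v x)) $ i = b1 $ i" using i v b1 by simp
      qed (use dims b1 in simp)
    next
      assume "G1 *\<^sub>v (H *\<^sub>v x) = b1"
      then show "fnorm (G1 *\<^sub>v (H *\<^sub>v x) - b1) = 0" using b1 by (simp add: fnorm_def)
    qed
    also have "\<dots> \<longleftrightarrow> H *\<^sub>v x = c"
    proof
      assume *: "G1 *\<^sub>v (H *\<^sub>v x) = b1"
      have "D * G1 *\<^sub>v (H *\<^sub>v x) = c"
        unfolding c_def *[symmetric] by (rule assoc_mult_mat_vec[OF D(1) G1 Hx])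
      then show "H *\<^sub>v x = c" unfolding D(3) using Hx by simp
    next
      assume *: "H *\<^sub>v x = c"
      have "G1 *\<^sub>v c = G1 * D *\<^sub>v b1"
        unfolding c_def by (rule assoc_mult_mat_vec[OF G1 D(1) b1, symmetric])
      then show "G1 *\<^sub>v (H *\<^sub>v x) = b1" unfolding * D(2) using b1 by simp
    qed
    finally show ?thesis .
  qed

  have Ak: "A ^\<^sub>m k \<in> carrier_mat n n" using A by simp
  have range_carrier: "x \<in> carrier_vec n" if "x \<in> mat_range (A ^\<^sub>m k)" for x
    using that mult_mat_vec_carrier[OF Ak] unfolding mat_range_def carrier_matD[OF Ak] by auto
  \<comment> \<open>The range hypothesis on \<open>b1\<close> makes the minimum attainable: as \<open>A F = F (\<Sigma> K)\<close>, the map \<open>F\<close>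
    carries the range of \<open>(\<Sigma> K)\<^sup>k\<close> into that of \<open>A\<^sup>k\<close>.\<close>
  have Fc: "F *\<^sub>v c \<in> mat_range (A ^\<^sub>m k)"
  proof -
    have "c \<in> mat_range ((\<Sigma> * K) ^\<^sub>m k)"
      using drazin_inverse_range[OF SK b1_range] unfolding D_eq c_def .
    then obtain z where z: "z \<in> carrier_vec r" "c = (\<Sigma> * K) ^\<^sub>m k *\<^sub>v z"
      unfolding mat_range_def carrier_matD[OF pow_carrier_mat[OF SK]] by auto
    have AF: "A * F = F * (\<Sigma> * K)"
      unfolding HF[symmetric] A_FH using dims by (simp add: mult_assoc_mat_dims)
    have "F *\<^sub>v c = F * (\<Sigma> * K) ^\<^sub>m k *\<^sub>v z"
      unfolding z(2) by (rule assoc_mult_mat_vec[OF F pow_carrier_mat[OF SK] z(1), symmetric])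
    also have "\<dots> = A ^\<^sub>m k * F *\<^sub>v z"
      unfolding pow_mat_intertwine[OF A SK F AF] ..
    also have "\<dots> = A ^\<^sub>m k *\<^sub>v (F *\<^sub>v z)" by (rule assoc_mult_mat_vec[OF Ak F z(1)])
    finally have "F *\<^sub>v c = A ^\<^sub>m k *\<^sub>v (F *\<^sub>v z)" .
    moreover have "F *\<^sub>v z \<in> carrier_vec n" using F z by simp
    ultimately show ?thesis unfolding mat_range_def carrier_matD[OF Ak] by blast
  qed
  note DA = drazin_inverse(1)[OF A]
  \<comment> \<open>\<open>A A\<^sup>m b = F D F\<^sup>* G (G U) (b1, b2) = F D b1\<close>, where \<open>A\<^sup>m\<close> is the Minkowski inverse.\<close>
  have sol: "m_DMP_inverse A *\<^sub>v b = drazin_inverse A *\<^sub>v (F *\<^sub>v c)"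
  proof -
    have mink: "minkowski_inverse A \<in> carrier_mat n n"
      unfolding A_FH minkowski_inverse_of_full_rank_factorization(1)[OF F H D(1) N(1),
          folded G, unfolded G1_eq, folded M_def, OF D(2) N(2)]
      by (rule carrier_matI) (simp_all add: dims)
    have "m_DMP_inverse A * W = drazin_inverse A * (A * minkowski_inverse A) * W"
      unfolding m_DMP_inverse_def using dims carrier_matD[OF DA] carrier_matD[OF mink] carrier_matD[OF W]
      by (simp add: mult_assoc_mat_dims)
    also have "\<dots> = drazin_inverse A * (F * (D * mat_adjoint J))"
      unfolding AMink W_def F_def using dims carrier_matD[OF DA] carrier_matD[OF D(1)] UU
      by (simp add: mat_adjoint_mult mult_assoc_mat_dims Gs)
    finally have *: "m_DMP_inverse A * W = drazin_inverse A * (F * (D * mat_adjoint J))" .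
    have dmp: "m_DMP_inverse A \<in> carrier_mat n n"
      unfolding m_DMP_inverse_def using DA A mink by auto
    have "m_DMP_inverse A *\<^sub>v b = m_DMP_inverse A * W *\<^sub>v (b1 @\<^sub>v b2)"
      unfolding b W_def[symmetric] by (rule assoc_mult_mat_vec[OF dmp W bb, symmetric])
    also have "\<dots> = drazin_inverse A *\<^sub>v (F *\<^sub>v (D *\<^sub>v (mat_adjoint J *\<^sub>v (b1 @\<^sub>v b2))))"
    proof -
      have "drazin_inverse A * (F * (D * mat_adjoint J)) *\<^sub>v v =
          drazin_inverse A *\<^sub>v (F *\<^sub>v (D *\<^sub>v (mat_adjoint J *\<^sub>v v)))" if "v \<in> carrier_vec n" for v
        using that dims carrier_matD[OF DA] carrier_matD[OF D(1)]
        by (simp add: mult_assoc_mat_vec_dims)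
      then show ?thesis unfolding * using bb .
    qed
    also have "mat_adjoint J *\<^sub>v (b1 @\<^sub>v b2) = b1"
      unfolding J_def by (rule adjoint_coord_embedding_append[OF b1 b2'])
    finally show ?thesis unfolding c_def .
  qed
  define x0 where "x0 = m_DMP_inverse A *\<^sub>v b"
  note core = drazin_inverse_on_core_range[OF A, folded k]
  have x0: "x0 \<in> mat_range (A ^\<^sub>m k)" unfolding x0_def sol by (rule core(3)[OF Fc])
  have Ax: "A *\<^sub>v x = F *\<^sub>v (H *\<^sub>v x)" if "x \<in> carrier_vec n" for x
    unfolding A_FH by (rule assoc_mult_mat_vec[OF F H that])
  have cFv: "mat_adjoint F *\<^sub>v (F *\<^sub>v u) = u" if "u \<in> carrier_vec r" for u
    using arg_cong[OF FF, of "\<lambda>Z. Z *\<^sub>v u"] that dims by (simp add: mult_assoc_mat_vec_dims)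
  have "H *\<^sub>v x0 = c"
  proof -
    have "F *\<^sub>v (H *\<^sub>v x0) = F *\<^sub>v c"
      using core(2)[OF Fc] Ax[OF range_carrier[OF x0]] unfolding x0_def sol by simp
    then have "mat_adjoint F *\<^sub>v (F *\<^sub>v (H *\<^sub>v x0)) = mat_adjoint F *\<^sub>v (F *\<^sub>v c)" by simp
    then show ?thesis using cFv c H range_carrier[OF x0] by simp
  qed
  then have f_x0: "f x0 = fnorm b2" using f_eq[OF range_carrier[OF x0]] by simp
  have unique: "x = x0" if x: "x \<in> mat_range (A ^\<^sub>m k)" and fx: "f x = fnorm b2" for x
  proof -
    have "A *\<^sub>v x = F *\<^sub>v c" using f_eq[OF range_carrier[OF x]] fx Ax[OF range_carrier[OF x]] by simp
    then show ?thesis using core(1)[OF x] unfolding x0_def sol by simp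
  qed
  have lower: "\<forall>x \<in> mat_range (A ^\<^sub>m k). fnorm b2 \<le> f x" using f_ge range_carrier by blast
  have "is_arg_min f (\<lambda>x. x \<in> mat_range (A ^\<^sub>m k)) x \<longleftrightarrow> x = x0" for x
  proof
    assume "is_arg_min f (\<lambda>x. x \<in> mat_range (A ^\<^sub>m k)) x"
    then have x: "x \<in> mat_range (A ^\<^sub>m k)" and "\<not> f x0 < f x"
      using x0 unfolding is_arg_min_def by auto
    then show "x = x0" using unique[OF x] lower f_x0 by force
  next
    assume "x = x0"
    then show "is_arg_min f (\<lambda>x. x \<in> mat_range (A ^\<^sub>m k)) x"
      using x0 lower f_x0 unfolding is_arg_min_def by (auto simp: not_less)
  qed
  then show ?thesis
    using x0 f_x0 lower unfolding Let_def f_def[symmetric] x0_def[symmetric] by blast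
qed

end
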